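(* Let $E$ be a real Banach space and let $\mathcal{T} = (T_t)_{t \in (0,\infty)}$ be a semigroup on $E$ which is locally bounded at $0$. Fix $t_0 \in (0,\infty)$. (a) The semigroup $(T_t)_{t \in (0,\infty)}$ converges strongly (as $t\to\infty$) to a rank-$1$ operator if and only if the semigroup $(T_{nt_0})_{n \in \mathbb{N}}$ converges strongly (as $n\to\infty$) to a rank-$1$ operator. In this case, both limit operators coincide. (b) The semigroup $(T_t)_{t \in (0,\infty)}$ converges to a rank-$1$ operator with respect to the operator norm if and only if the semigroup $(T_{nt_0})_{n \in \mathbb{N}}$ converges to a rank-$1$ operator with respect to the operator norm. In this case, both limit operators coincide.
   Context: $\mathbb{N} = \{1,2,\dots\}$. A semigroup $(T_t)_{t \in (0,\infty)}$ on $E$ is a family of bounded linear operators on $E$ with $T_{t+s} = T_tT_s$ for all $s,t > 0$; no continuity in $t$ is assumed. It is locally bounded at $0$ if for one (equivalently, all) $c \in (0,\infty)$ one has $\sup_{t \in (0,c]}\|T_t\| < \infty$. Strong convergence means convergence in the strong operator topology. A rank-$1$ operator is a bounded linear operator with one-dimensional range. *)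

theory Defs
  imports "HOL-Analysis.Analysis"
begin

text \<open>
  A semigroup \<open>(T\<^sub>t)\<close> with \<open>t\<close> in \<open>(0,\<infinity>)\<close> is represented by a function on all reals of which only
  the values at positive arguments are constrained; in particular \<open>T 0\<close> is arbitrary.
\<close>

definition operator_semigroup :: "(real \<Rightarrow> 'a::real_normed_vector \<Rightarrow>\<^sub>L 'a) \<Rightarrow> bool" where
  "operator_semigroup T \<longleftrightarrow> (\<forall>s>0. \<forall>t>0. T (t + s) = T t o\<^sub>L T s)"

definition locally_bounded_at_0 :: "(real \<Rightarrow> 'a::real_normed_vector \<Rightarrow>\<^sub>L 'a) \<Rightarrow> bool" where
  "locally_bounded_at_0 T \<longleftrightarrow> (\<exists>c>0. bdd_above ((\<lambda>t. norm (T t)) ` {0<..c}))"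

text \<open>
  The library's \<^const>\<open>dim\<close> is \<open>0\<close> on infinite-dimensional spaces, so the value \<open>1\<close> does mean that
  the range is one-dimensional.
\<close>

definition rank_one :: "('a::real_normed_vector \<Rightarrow>\<^sub>L 'b::real_normed_vector) \<Rightarrow> bool" where
  "rank_one P \<longleftrightarrow> dim (range (blinfun_apply P)) = 1"

end

theory Submission
  imports Defs
begin

text \<open>
  Suppose that \<open>T (n * t0)\<close> converges strongly to a rank-one operator \<open>Q\<close>, whose range is spanned
  by \<open>u\<close>. Every \<open>T t\<close> commutes with all the \<open>T (n * t0)\<close>, hence with \<open>Q\<close>, so it maps the line through
  \<open>u\<close> into itself and acts there as multiplication by a real number \<open>f t\<close>. Since \<open>T t0\<close> fixes the
  range of \<open>Q\<close>, the function \<open>f\<close> is multiplicative with \<open>f t0 = 1\<close>, and it is bounded near \<open>0\<close>.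
  The only real multiplicative function with these properties is constantly \<open>1\<close>
  (\<open>bounded_periodic_character_trivial\<close>): the values are squares, their powers stay bounded, and each
  is the reciprocal of another. Thus the whole semigroup fixes the range of \<open>Q\<close>, that is,
  \<open>T t o\<^sub>L Q = Q\<close> for all \<open>t > 0\<close> (\<open>semigroup_fixes_rank_one_limit\<close>).

  With \<open>t = n * t0 + s\<close> and \<open>0 < s \<le> t0\<close> this gives \<open>T t - Q = T s o\<^sub>L (T (n * t0) - Q)\<close>. The factors
  \<open>T s\<close> are uniformly bounded by local boundedness, so \<open>T t\<close> tends to \<open>Q\<close> in whichever of the two
  topologies \<open>T (n * t0)\<close> does. The converse and the uniqueness of the limit are the passage to a
  subsequence.

  Rank one enters through the triviality of \<open>f\<close>: on a range of dimension two, a rotation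
  group of period \<open>t0\<close> is constant along \<open>n * t0\<close> without converging.
\<close>

section \<open>Real multiplicative functions on the positive half-line\<close>

lemma multiplicative_on_pos_power:
  fixes f :: "real \<Rightarrow> real"
  assumes mult: "\<And>s t. s > 0 \<Longrightarrow> t > 0 \<Longrightarrow> f (s + t) = f s * f t"
    and "t > 0"
  shows "f (real (Suc n) * t) = f t ^ Suc n"
proof (induction n)
  case (Suc n)
  have "f (real (Suc (Suc n)) * t) = f (t + real (Suc n) * t)"
    by (simp add: algebra_simps)
  also have "\<dots> = f t * f (real (Suc n) * t)"
    using \<open>t > 0\<close> by (intro mult) auto
  finally show ?case using Suc.IH by simp
qed simp

text \<open>
  Taking \<open>s\<close> in \<open>{0<..p}\<close> rather than \<open>{0..<p}\<close> keeps the remainder inside the parameter range of a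
  semigroup without an operator at time \<open>0\<close>.
\<close>

lemma positive_real_division:
  fixes p t :: real
  assumes "p > 0" "t > 0"
  obtains n :: nat and s where "0 < s" "s \<le> p" "t = real n * p + s"
proof -
  define m where "m = \<lceil>t / p\<rceil>"
  have m: "real_of_int m - 1 < t / p" "t / p \<le> real_of_int m"
    unfolding m_def by linarith+
  have "m \<ge> 1"
    using assms by (simp add: m_def)
  then have "real (nat (m - 1)) = real_of_int m - 1"
    by simp
  with m that[of "t - real (nat (m - 1)) * p" "nat (m - 1)"] \<open>p > 0\<close> show thesis
    by (simp add: field_simps)
qed

lemma bounded_periodic_character_trivial:
  fixes f :: "real \<Rightarrow> real"
  assumes mult: "\<And>s t. s > 0 \<Longrightarrow> t > 0 \<Longrightarrow> f (s + t) = f s * f t"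
    and "p > 0" "f p = 1"
    and bound: "\<And>t. 0 < t \<Longrightarrow> t \<le> p \<Longrightarrow> \<bar>f t\<bar> \<le> M"
    and "t > 0"
  shows "f t = 1"
proof -
  have period: "f (real (Suc n) * p) = 1" for n
    using multiplicative_on_pos_power[OF mult \<open>p > 0\<close>] \<open>f p = 1\<close> by simp
  have global_bound: "\<bar>f r\<bar> \<le> M" if "r > 0" for r
  proof -
    obtain n s where s: "0 < s" "s \<le> p" "r = real n * p + s"
      using positive_real_division[OF \<open>p > 0\<close> \<open>r > 0\<close>] .
    have "f r = f s"
    proof (cases n)
      case (Suc k)
      then show ?thesis
        using s mult[of "real n * p" s] period[of k] \<open>p > 0\<close> by simp
    qed (use s in simp)
    with s bound show ?thesis by simp
  qed
  have le_one: "f r \<le> 1" if "r > 0" for r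
  proof (rule ccontr)
    assume "\<not> f r \<le> 1"
    then obtain n where n: "M < f r ^ n"
      using real_arch_pow[of "f r" M] by auto
    also have "\<dots> \<le> f r ^ Suc n"
      using \<open>\<not> f r \<le> 1\<close> by (intro power_increasing) auto
    also have "\<dots> = f (real (Suc n) * r)"
      using multiplicative_on_pos_power[OF mult \<open>r > 0\<close>] by simp
    also have "\<dots> \<le> M"
      using global_bound[of "real (Suc n) * r"] \<open>r > 0\<close> by simp
    finally show False by simp
  qed
  have nonneg: "f r \<ge> 0" if "r > 0" for r
    using mult[of "r / 2" "r / 2"] that by simp
  \<comment> \<open>\<open>f r\<close> is the reciprocal of \<open>f t\<close>, and neither exceeds \<open>1\<close>.\<close>
  obtain n where n: "t < real n * p"
    using reals_Archimedean3[OF \<open>p > 0\<close>] by blast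
  then obtain k where k: "n = Suc k"
    using \<open>t > 0\<close> by (cases n) auto
  define r where "r = real n * p - t"
  have "r > 0" and "f t * f r = 1"
    using n mult[of t r] \<open>t > 0\<close> period[of k] by (simp_all add: r_def k)
  then have "1 \<le> f t"
    using mult_left_mono[of "f r" 1 "f t"] le_one nonneg \<open>t > 0\<close> by simp
  with le_one \<open>t > 0\<close> show ?thesis
    by (simp add: order_antisym)
qed

section \<open>Limits along the multiples of a period\<close>

text \<open>
  Stated for functions into a normed space so that it serves both the operator norm (for \<open>T\<close> itself)
  and the strong topology (for the orbits \<open>\<lambda>t. T t x\<close>). The bound is asked only for \<open>n > 0\<close>, as
  \<open>T 0\<close> is not part of the semigroup.
\<close>

lemma tendsto_at_top_from_multiples:
  fixes F :: "real \<Rightarrow> 'b::real_normed_vector"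
  assumes "p > 0"
    and lim: "(\<lambda>n. F (real n * p)) \<longlonglongrightarrow> L"
    and bound: "\<And>n s. n > 0 \<Longrightarrow> 0 < s \<Longrightarrow> s \<le> p \<Longrightarrow>
      norm (F (real n * p + s) - L) \<le> M * norm (F (real n * p) - L)"
  shows "(F \<longlongrightarrow> L) at_top"
proof (rule tendstoI)
  fix e :: real assume "e > 0"
  have "(\<lambda>n. M * norm (F (real n * p) - L)) \<longlonglongrightarrow> M * norm (L - L)"
    by (intro tendsto_intros lim)
  then have "eventually (\<lambda>n. M * norm (F (real n * p) - L) < e) sequentially"
    using \<open>e > 0\<close> by (intro order_tendstoD(2)) auto
  then obtain N where N: "\<And>n. n \<ge> N \<Longrightarrow> M * norm (F (real n * p) - L) < e"
    by (auto simp: eventually_sequentially)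
  have "dist (F t) L < e" if t: "t > real (Suc N) * p" for t
  proof -
    have "t > 0"
      using t \<open>p > 0\<close> by (meson mult_nonneg_nonneg of_nat_0_le_iff less_imp_le le_less_trans)
    then obtain n s where s: "0 < s" "s \<le> p" "t = real n * p + s"
      using positive_real_division[OF \<open>p > 0\<close>] by blast
    have "n > N"
    proof (rule ccontr)
      assume "\<not> n > N"
      then have "real n * p \<le> real N * p"
        using \<open>p > 0\<close> by simp
      moreover have "real (Suc N) * p = real N * p + p"
        by (simp add: algebra_simps)
      ultimately show False using s t by linarith
    qed
    with bound[of n s] N[of n] s show ?thesis
      by (simp add: dist_norm)
  qed
  then show "eventually (\<lambda>t. dist (F t) L < e) at_top"
    using eventually_gt_at_top by (rule eventually_mono[rotated])
qed

lemma filterlim_multiples_at_top: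
  fixes p :: real
  assumes "p > 0"
  shows "filterlim (\<lambda>n. real n * p) at_top sequentially"
  using assms by (intro filterlim_at_top_mult_tendsto_pos[OF tendsto_const _ filterlim_real_sequentially])

lemma limitin_strong_operator_topology_iff:
  "limitin strong_operator_topology f l F \<longleftrightarrow> (\<forall>x. ((\<lambda>a. blinfun_apply (f a) x) \<longlongrightarrow> blinfun_apply l x) F)"
proof -
  have "limitin strong_operator_topology f l F \<longleftrightarrow>
    limitin euclidean (\<lambda>a. blinfun_apply (f a)) (blinfun_apply l) F"
    unfolding limitin_def strong_operator_topology_def
    by (auto simp: openin_pullback_topology topspace_pullback_topology)
  also have "\<dots> \<longleftrightarrow> (\<forall>x. ((\<lambda>a. blinfun_apply (f a) x) \<longlongrightarrow> blinfun_apply l x) F)"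
    unfolding euclidean_product_topology[symmetric] limitin_componentwise by simp
  finally show ?thesis .
qed

section \<open>Operator semigroups\<close>

lemma semigroup_commute:
  assumes "operator_semigroup T" "s > 0" "t > 0"
  shows "T s o\<^sub>L T t = T t o\<^sub>L T s"
  using assms unfolding operator_semigroup_def by (metis add.commute)

lemma semigroup_norm_power_le:
  assumes "operator_semigroup T" "t > 0"
  shows "norm (T (real (Suc n) * t)) \<le> norm (T t) ^ Suc n"
proof (induction n)
  case (Suc n)
  have "T (real (Suc (Suc n)) * t) = T (t + real (Suc n) * t)"
    by (simp add: algebra_simps)
  also have "\<dots> = T t o\<^sub>L T (real (Suc n) * t)"
    using assms unfolding operator_semigroup_def by simp
  finally have "norm (T (real (Suc (Suc n)) * t)) \<le> norm (T t) * norm (T (real (Suc n) * t))"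
    by (simp add: norm_blinfun_compose)
  also have "\<dots> \<le> norm (T t) * norm (T t) ^ Suc n"
    by (intro mult_left_mono Suc.IH) simp
  finally show ?case by simp
qed simp

lemma semigroup_bounded_on_intervals:
  assumes sg: "operator_semigroup T" and "locally_bounded_at_0 T"
  obtains M where "\<And>s. 0 < s \<Longrightarrow> s \<le> b \<Longrightarrow> norm (T s) \<le> M"
proof -
  obtain c K where "c > 0" and K: "\<And>s. 0 < s \<Longrightarrow> s \<le> c \<Longrightarrow> norm (T s) \<le> K"
    using assms(2) unfolding locally_bounded_at_0_def bdd_above_def by fastforce
  obtain n where n: "b < real n * c"
    using reals_Archimedean3[OF \<open>c > 0\<close>] by blast
  have "norm (T s) \<le> K ^ Suc n" if s: "0 < s" "s \<le> b" for s
  proof -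
    \<comment> \<open>\<open>T s\<close> is a power of an operator from the interval where the bound is known.\<close>
    define r where "r = s / real (Suc n)"
    have "s = real (Suc n) * r"
      by (simp add: r_def)
    moreover have "b < real (Suc n) * c"
      using n \<open>c > 0\<close> by (simp add: algebra_simps)
    ultimately have "real (Suc n) * r \<le> real (Suc n) * c"
      using s by linarith
    then have "r \<le> c" by (rule mult_left_le_imp_le) simp
    have "r > 0" using s by (simp add: r_def)
    have "norm (T s) \<le> norm (T r) ^ Suc n"
      using semigroup_norm_power_le[OF sg \<open>r > 0\<close>] \<open>s = _\<close> by simp
    also have "\<dots> \<le> K ^ Suc n"
      using K \<open>r > 0\<close> \<open>r \<le> c\<close> by (intro power_mono) auto
    finally show ?thesis .
  qed
  then show thesis using that by blast
qed

lemma rank_one_range: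
  assumes "rank_one P"
  obtains u where "u \<noteq> 0" "u \<in> range (blinfun_apply P)" "\<And>x. \<exists>c. blinfun_apply P x = c *\<^sub>R u"
proof -
  obtain B where B: "B \<subseteq> range (blinfun_apply P)" "independent B"
      "range (blinfun_apply P) \<subseteq> span B" "card B = 1"
    using assms basis_exists[of "range (blinfun_apply P)"] unfolding rank_one_def by metis
  then obtain u where "B = {u}"
    by (auto simp: card_1_singleton_iff)
  with B have "u \<noteq> 0" "u \<in> range (blinfun_apply P)" "\<And>x. P x \<in> span {u}"
    by (auto simp: subset_iff)
  with that show thesis
    by (auto simp: span_singleton image_iff)
qed

text \<open>
  The limit commutes with the semigroup because the approximants \<open>T (n * t0)\<close> do, and it absorbs
  \<open>T t0\<close> because composing with \<open>T t0\<close> only shifts the sequence by one place.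
\<close>

lemma strong_limit_commutes:
  assumes sg: "operator_semigroup T" and "t0 > 0"
    and lim: "\<And>x. (\<lambda>n. T (real n * t0) x) \<longlonglongrightarrow> Q x"
    and "t > 0"
  shows "T t (Q x) = Q (T t x)"
proof (rule LIMSEQ_unique)
  show "(\<lambda>n. T (real n * t0) (T t x)) \<longlonglongrightarrow> Q (T t x)"
    by (rule lim)
  have "(\<lambda>n. T t (T (real n * t0) x)) \<longlonglongrightarrow> T t (Q x)"
    by (intro tendsto_intros lim)
  moreover have "eventually (\<lambda>n. T t (T (real n * t0) x) = T (real n * t0) (T t x)) sequentially"
    using eventually_gt_at_top[of 0]
  proof eventually_elim
    case (elim n)
    then show ?case
      using semigroup_commute[OF sg \<open>t > 0\<close>, of "real n * t0"] \<open>t0 > 0\<close>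
      by (metis blinfun_apply_blinfun_compose mult_pos_pos of_nat_0_less_iff)
  qed
  ultimately show "(\<lambda>n. T (real n * t0) (T t x)) \<longlonglongrightarrow> T t (Q x)"
    by (rule Lim_transform_eventually)
qed

lemma strong_limit_absorbs_step:
  assumes sg: "operator_semigroup T" and "t0 > 0"
    and lim: "\<And>x. (\<lambda>n. T (real n * t0) x) \<longlonglongrightarrow> Q x"
  shows "T t0 (Q x) = Q x"
proof (rule LIMSEQ_unique)
  show "(\<lambda>n. T (real (Suc n) * t0) x) \<longlonglongrightarrow> Q x"
    using lim by (rule LIMSEQ_Suc)
  have "(\<lambda>n. T t0 (T (real n * t0) x)) \<longlonglongrightarrow> T t0 (Q x)"
    by (intro tendsto_intros lim)
  moreover have "eventually (\<lambda>n. T t0 (T (real n * t0) x) = T (real (Suc n) * t0) x) sequentially"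
    using eventually_gt_at_top[of 0]
  proof eventually_elim
    case (elim n)
    then have "T (t0 + real n * t0) = T t0 o\<^sub>L T (real n * t0)"
      using sg \<open>t0 > 0\<close> unfolding operator_semigroup_def by simp
    then show ?case by (simp add: algebra_simps)
  qed
  ultimately show "(\<lambda>n. T (real (Suc n) * t0) x) \<longlonglongrightarrow> T t0 (Q x)"
    by (rule Lim_transform_eventually)
qed

text \<open>
  \<open>T t\<close> commutes with \<open>Q\<close>, so it preserves the range of \<open>Q\<close>. That range being a line, the semigroup
  acts on it by real scalars, and these form a multiplicative function that is bounded and has the
  value \<open>1\<close> at \<open>t0\<close>.
\<close>

lemma semigroup_fixes_rank_one_limit:
  assumes sg: "operator_semigroup T" and lb: "locally_bounded_at_0 T" and "t0 > 0"
    and "rank_one Q"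
    and lim: "\<And>x. (\<lambda>n. T (real n * t0) x) \<longlonglongrightarrow> Q x"
    and "t > 0"
  shows "T t o\<^sub>L Q = Q"
proof -
  obtain u where u: "u \<noteq> 0" "u \<in> range (blinfun_apply Q)" "\<And>x. \<exists>c. Q x = c *\<^sub>R u"
    using rank_one_range[OF \<open>rank_one Q\<close>] by blast
  obtain y where y: "u = Q y"
    using u(2) by auto
  have "\<exists>c. T s u = c *\<^sub>R u" if "s > 0" for s
    using strong_limit_commutes[OF sg \<open>t0 > 0\<close> lim that] u(3) y by metis
  then obtain f where f: "\<And>s. s > 0 \<Longrightarrow> T s u = f s *\<^sub>R u"
    by metis
  obtain M where M: "\<And>s. 0 < s \<Longrightarrow> s \<le> t0 \<Longrightarrow> norm (T s) \<le> M"
    using semigroup_bounded_on_intervals[OF sg lb] by blast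
  have "f t = 1"
  proof (rule bounded_periodic_character_trivial[where f = f and p = t0 and M = M])
    fix r s :: real assume rs: "r > 0" "s > 0"
    then have "T (r + s) u = T r (T s u)"
      using sg unfolding operator_semigroup_def by simp
    then have "f (r + s) *\<^sub>R u = (f r * f s) *\<^sub>R u"
      using rs f by (simp add: blinfun.scaleR_right mult.commute)
    then show "f (r + s) = f r * f s"
      using u(1) by simp
  next
    have "f t0 *\<^sub>R u = 1 *\<^sub>R u"
      using strong_limit_absorbs_step[OF sg \<open>t0 > 0\<close> lim, of y] f[OF \<open>t0 > 0\<close>] y by simp
    then show "f t0 = 1"
      using u(1) unfolding scaleR_cancel_right by simp
  next
    fix s :: real assume s: "0 < s" "s \<le> t0"
    have "\<bar>f s\<bar> * norm u \<le> norm (T s) * norm u"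
      using norm_blinfun[of "T s" u] f[OF s(1)] by simp
    then show "\<bar>f s\<bar> \<le> M"
      using u(1) M[OF s] by simp
  qed (use \<open>t0 > 0\<close> \<open>t > 0\<close> in auto)
  then have "T t u = u"
    using f \<open>t > 0\<close> by simp
  then show ?thesis
    using u(3) by (intro blinfun_eqI) (metis blinfun.scaleR_right blinfun_apply_blinfun_compose)
qed

text \<open>
  This turns a bound on \<open>T\<close> over one period into control of the error between consecutive
  multiples of \<open>t0\<close>.
\<close>

lemma semigroup_error_factorization:
  assumes "operator_semigroup T" "r > 0" "s > 0" "T s o\<^sub>L Q = Q"
  shows "T (r + s) - Q = T s o\<^sub>L (T r - Q)"
proof -
  have "T (r + s) = T s o\<^sub>L T r"
    using assms unfolding operator_semigroup_def by (metis add.commute)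
  moreover have "Q x = T s (Q x)" for x
    using assms(4) by (metis blinfun_apply_blinfun_compose)
  ultimately show ?thesis
    by (intro blinfun_eqI) (simp add: blinfun.diff_left blinfun.diff_right)
qed

lemma rank_one_limit_from_multiples:
  assumes sg: "operator_semigroup T" and lb: "locally_bounded_at_0 T" and "t0 > 0"
    and "rank_one Q"
    and lim: "\<And>x. (\<lambda>n. T (real n * t0) x) \<longlonglongrightarrow> Q x"
  shows strong_limit_from_multiples: "((\<lambda>t. T t x) \<longlongrightarrow> Q x) at_top"
    and norm_limit_from_multiples: "(\<lambda>n. T (real n * t0)) \<longlonglongrightarrow> Q \<Longrightarrow> (T \<longlongrightarrow> Q) at_top"
proof -
  obtain M where M: "\<And>s. 0 < s \<Longrightarrow> s \<le> t0 \<Longrightarrow> norm (T s) \<le> M"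
    using semigroup_bounded_on_intervals[OF sg lb] by blast
  have error: "T (real n * t0 + s) - Q = T s o\<^sub>L (T (real n * t0) - Q)" if "n > 0" "0 < s" for n s
    using that \<open>t0 > 0\<close>
      semigroup_fixes_rank_one_limit[OF sg lb \<open>t0 > 0\<close> \<open>rank_one Q\<close> lim]
    by (intro semigroup_error_factorization[OF sg]) auto
  show "((\<lambda>t. T t x) \<longlongrightarrow> Q x) at_top"
  proof (rule tendsto_at_top_from_multiples[OF \<open>t0 > 0\<close> lim])
    fix n :: nat and s :: real assume *: "n > 0" "0 < s" "s \<le> t0"
    have "T (real n * t0 + s) x - Q x = T s (T (real n * t0) x - Q x)"
      using arg_cong[OF error[OF *(1,2)], of "\<lambda>A. blinfun_apply A x"]
      by (simp add: blinfun.diff_left)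
    then have "norm (T (real n * t0 + s) x - Q x) \<le> norm (T s) * norm (T (real n * t0) x - Q x)"
      by (simp add: norm_blinfun)
    also have "\<dots> \<le> M * norm (T (real n * t0) x - Q x)"
      using M * by (intro mult_right_mono) auto
    finally show "norm (T (real n * t0 + s) x - Q x) \<le> M * norm (T (real n * t0) x - Q x)" .
  qed
  show "(T \<longlongrightarrow> Q) at_top" if "(\<lambda>n. T (real n * t0)) \<longlonglongrightarrow> Q"
  proof (rule tendsto_at_top_from_multiples[OF \<open>t0 > 0\<close> that])
    fix n :: nat and s :: real assume *: "n > 0" "0 < s" "s \<le> t0"
    have "norm (T (real n * t0 + s) - Q) \<le> norm (T s) * norm (T (real n * t0) - Q)"
      unfolding error[OF *(1,2)] by (rule norm_blinfun_compose)
    also have "\<dots> \<le> M * norm (T (real n * t0) - Q)"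
      using M * by (intro mult_right_mono) auto
    finally show "norm (T (real n * t0 + s) - Q) \<le> M * norm (T (real n * t0) - Q)" .
  qed
qed

section \<open>Rank-one limits of the semigroup\<close>

theorem theorem2p3:
  fixes T :: "real \<Rightarrow> 'a::banach \<Rightarrow>\<^sub>L 'a" and t0 :: real
  assumes "operator_semigroup T"
    and "locally_bounded_at_0 T"
    and "t0 > 0"
  shows
    "((\<exists>P. rank_one P \<and> limitin strong_operator_topology T P at_top) \<longleftrightarrow>
      (\<exists>Q. rank_one Q \<and>
        limitin strong_operator_topology (\<lambda>n::nat. T (real n * t0)) Q sequentially)) \<and>
     (\<forall>P Q. rank_one P \<and> limitin strong_operator_topology T P at_top \<and>
        rank_one Q \<and> limitin strong_operator_topology (\<lambda>n::nat. T (real n * t0)) Q sequentially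
        \<longrightarrow> P = Q) \<and>
     ((\<exists>P. rank_one P \<and> (T \<longlongrightarrow> P) at_top) \<longleftrightarrow>
      (\<exists>Q. rank_one Q \<and> (\<lambda>n::nat. T (real n * t0)) \<longlonglongrightarrow> Q)) \<and>
     (\<forall>P Q. rank_one P \<and> (T \<longlongrightarrow> P) at_top \<and>
        rank_one Q \<and> (\<lambda>n::nat. T (real n * t0)) \<longlonglongrightarrow> Q
        \<longrightarrow> P = Q)"
proof -
  let ?S = "\<lambda>n::nat. T (real n * t0)"
  let ?strong = "\<lambda>P. limitin strong_operator_topology T P at_top"
  let ?strong' = "\<lambda>Q. limitin strong_operator_topology ?S Q sequentially"
  note sub = filterlim_compose[OF _ filterlim_multiples_at_top[OF \<open>t0 > 0\<close>]]
  have strong_sub: "?strong' P" if "?strong P" for P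
    using that sub unfolding limitin_strong_operator_topology_iff by blast
  have norm_sub: "?S \<longlonglongrightarrow> P" if "(T \<longlongrightarrow> P) at_top" for P
    using that by (rule sub)
  have strong: "?strong Q" if "rank_one Q" "?strong' Q" for Q
    using that strong_limit_from_multiples[OF assms that(1)]
    unfolding limitin_strong_operator_topology_iff by blast
  have norm: "(T \<longlongrightarrow> Q) at_top" if "rank_one Q" "?S \<longlonglongrightarrow> Q" for Q
    using that(2) by (intro norm_limit_from_multiples[OF assms that(1)]) (auto intro: tendsto_intros)
  have strong_unique: "P = Q" if "?strong P" "?strong' Q" for P Q
    using strong_sub[OF that(1)] that(2) unfolding limitin_strong_operator_topology_iff
    by (intro blinfun_eqI) (blast intro: LIMSEQ_unique)
  have norm_unique: "P = Q" if "(T \<longlongrightarrow> P) at_top" "?S \<longlonglongrightarrow> Q" for P Q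
    using norm_sub[OF that(1)] that(2) by (rule LIMSEQ_unique)
  show ?thesis
    using strong_sub norm_sub strong norm strong_unique norm_unique by blast
qed

end
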